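(* Let $G=(V,E)$ be a connected locally finite weighted graph with symmetric positive edge weights $w_{xy}$ and vertex measure $\mu:V\to(0,\infty)$. Suppose there is a constant $\mu_0>0$ with $\mu(x)\ge\mu_0$ for all $x\in V$. Let $h,g,f:V\to\mathbb{R}$ be functions such that there exists a constant $a_0>0$ with $h(x)\ge a_0$ for all $x\in V$; $g\ge0$ and $g\not\equiv0$ on $V$, $g\in L^1(V)$; and $f\in L^q(V)$ for some $q\in[1,2]$. Then the equation $$-\Delta u+hu=\frac{ge^u}{\int_Vge^u\,d\mu}-f\quad\text{in } V,\qquad u\in\mathscr{H}\cap L^\infty(V),$$ has a solution.
   Context: $G=(V,E)$ is a connected graph with vertex set $V$ and edge set $E$; $y\sim x$ means $xy\in E$. Each edge $xy\in E$ has a weight $w_{xy}>0$ with $w_{xy}=w_{yx}$, and $\mu:V\to(0,\infty)$ is a measure on the vertices. The distance $\rho(x,O)$ between $x$ and $O$ is the number of edges of a shortest path joining them (and $\rho(O,O)=0$). The graph is locally finite if for every $O\in V$ and every integer $k\ge1$ the ball $B_k=\{x\in V:\rho(x,O)<k\}$ is finite. For $f:V\to\mathbb{R}$, $\int_V f\,d\mu=\sum_{x\in V}\mu(x)f(x)$. For $q>0$, $L^q(V)$ is the space of functions $f:V\to\mathbb{R}$ with $\|f\|_{L^q(V)}=\left(\int_V|f|^q\,d\mu\right)^{1/q}<\infty$; $L^\infty(V)$ is the space of bounded functions on $V$. The Laplacian is $\Delta u(x)=\frac{1}{\mu(x)}\sum_{y\sim x}w_{xy}(u(y)-u(x))$,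 and $|\nabla u|(x)=\left(\frac{1}{2\mu(x)}\sum_{y\sim x}w_{xy}(u(y)-u(x))^2\right)^{1/2}$. $W^{1,2}(V)$ is the space of functions $u:V\to\mathbb{R}$ with $\|u\|_{W^{1,2}(V)}=\left(\int_V(|\nabla u|^2+u^2)\,d\mu\right)^{1/2}<\infty$, and $W_0^{1,2}(V)$ is the completion (closure in $W^{1,2}(V)$) of the finitely supported functions $C_c(V)$ under this norm. For $h$ with a positive lower bound, $\mathscr{H}=\{u\in W_0^{1,2}(V):\int_V(|\nabla u|^2+hu^2)\,d\mu<\infty\}$. The equation is understood pointwise at every $x\in V$. *)

theory Defs
  imports "HOL-Analysis.Analysis"
begin

text \<open>
  Functions on the vertex set \<open>V\<close> are total functions \<open>'a \<Rightarrow> real\<close> of which only the values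
  on \<open>V\<close> matter; an edge is represented by both of its orientations in the relation \<open>E\<close>,
  and the values of \<open>w\<close> outside \<open>E\<close> are irrelevant.
\<close>

locale connected_weighted_graph =
  fixes V :: "'a set" and E :: "('a \<times> 'a) set"
    and w :: "'a \<Rightarrow> 'a \<Rightarrow> real" and \<mu> :: "'a \<Rightarrow> real"
  assumes edges_in_verts: "E \<subseteq> V \<times> V"
    and sym_edges: "sym E"
    and irrefl_edges: "irrefl E"
    and connected_edges: "\<And>x y. x \<in> V \<Longrightarrow> y \<in> V \<Longrightarrow> (x, y) \<in> E\<^sup>*"
    and weight_pos: "\<And>x y. (x, y) \<in> E \<Longrightarrow> w x y > 0"
    and weight_sym: "\<And>x y. (x, y) \<in> E \<Longrightarrow> w x y = w y x"
    and measure_pos: "\<And>x. x \<in> V \<Longrightarrow> \<mu> x > 0"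

text \<open>The least length of a walk from \<open>x\<close> to \<open>y\<close>; a walk of least length is a path.\<close>

definition graph_dist :: "('a \<times> 'a) set \<Rightarrow> 'a \<Rightarrow> 'a \<Rightarrow> nat" where
  "graph_dist E x y = (LEAST n. (x, y) \<in> E ^^ n)"

definition locally_finite_graph :: "'a set \<Rightarrow> ('a \<times> 'a) set \<Rightarrow> bool" where
  "locally_finite_graph V E \<longleftrightarrow>
     (\<forall>z\<in>V. \<forall>k\<ge>1. finite {x \<in> V. graph_dist E x z < k})"

definition vertex_integral :: "'a set \<Rightarrow> ('a \<Rightarrow> real) \<Rightarrow> ('a \<Rightarrow> real) \<Rightarrow> real" where
  "vertex_integral V \<mu> f = (\<Sum>\<^sub>\<infinity>x\<in>V. \<mu> x * f x)"

text \<open>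
  For a function that is nonnegative on \<open>V\<close> this says that its integral is finite. It has to be
  stated separately because \<open>infsum\<close> is \<open>0\<close> on families that are not summable.
\<close>

definition vertex_integrable :: "'a set \<Rightarrow> ('a \<Rightarrow> real) \<Rightarrow> ('a \<Rightarrow> real) \<Rightarrow> bool" where
  "vertex_integrable V \<mu> f \<longleftrightarrow> (\<lambda>x. \<mu> x * f x) summable_on V"

definition Lq_space :: "'a set \<Rightarrow> ('a \<Rightarrow> real) \<Rightarrow> real \<Rightarrow> ('a \<Rightarrow> real) set" where
  "Lq_space V \<mu> q = {f. vertex_integrable V \<mu> (\<lambda>x. \<bar>f x\<bar> powr q)}"

definition Linf_space :: "'a set \<Rightarrow> ('a \<Rightarrow> real) set" where
  "Linf_space V = {f. bounded (f ` V)}"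

definition laplacian ::
  "('a \<times> 'a) set \<Rightarrow> ('a \<Rightarrow> 'a \<Rightarrow> real) \<Rightarrow> ('a \<Rightarrow> real) \<Rightarrow> ('a \<Rightarrow> real) \<Rightarrow> 'a \<Rightarrow> real" where
  "laplacian E w \<mu> u x = 1 / \<mu> x * (\<Sum>y | (x, y) \<in> E. w x y * (u y - u x))"

definition grad_norm ::
  "('a \<times> 'a) set \<Rightarrow> ('a \<Rightarrow> 'a \<Rightarrow> real) \<Rightarrow> ('a \<Rightarrow> real) \<Rightarrow> ('a \<Rightarrow> real) \<Rightarrow> 'a \<Rightarrow> real" where
  "grad_norm E w \<mu> u x = sqrt (1 / (2 * \<mu> x) * (\<Sum>y | (x, y) \<in> E. w x y * (u y - u x)\<^sup>2))"

definition W12_space ::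
  "'a set \<Rightarrow> ('a \<times> 'a) set \<Rightarrow> ('a \<Rightarrow> 'a \<Rightarrow> real) \<Rightarrow> ('a \<Rightarrow> real) \<Rightarrow> ('a \<Rightarrow> real) set" where
  "W12_space V E w \<mu> = {u. vertex_integrable V \<mu> (\<lambda>x. (grad_norm E w \<mu> u x)\<^sup>2 + (u x)\<^sup>2)}"

definition W12_norm ::
  "'a set \<Rightarrow> ('a \<times> 'a) set \<Rightarrow> ('a \<Rightarrow> 'a \<Rightarrow> real) \<Rightarrow> ('a \<Rightarrow> real) \<Rightarrow> ('a \<Rightarrow> real) \<Rightarrow> real" where
  "W12_norm V E w \<mu> u = sqrt (vertex_integral V \<mu> (\<lambda>x. (grad_norm E w \<mu> u x)\<^sup>2 + (u x)\<^sup>2))"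

definition Cc_space :: "'a set \<Rightarrow> ('a \<Rightarrow> real) set" where
  "Cc_space V = {\<phi>. finite {x \<in> V. \<phi> x \<noteq> 0}}"

text \<open>
  The closure of the finitely supported functions in the \<open>W12_norm\<close>. On a locally finite
  graph these functions lie in \<open>W12_space\<close>, so the norm of the difference is a genuine one.
\<close>

definition W012_space ::
  "'a set \<Rightarrow> ('a \<times> 'a) set \<Rightarrow> ('a \<Rightarrow> 'a \<Rightarrow> real) \<Rightarrow> ('a \<Rightarrow> real) \<Rightarrow> ('a \<Rightarrow> real) set" where
  "W012_space V E w \<mu> = {u \<in> W12_space V E w \<mu>.
     \<forall>\<epsilon>>0. \<exists>\<phi>\<in>Cc_space V. W12_norm V E w \<mu> (\<lambda>x. u x - \<phi> x) < \<epsilon>}"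

definition H_space ::
  "'a set \<Rightarrow> ('a \<times> 'a) set \<Rightarrow> ('a \<Rightarrow> 'a \<Rightarrow> real) \<Rightarrow> ('a \<Rightarrow> real) \<Rightarrow> ('a \<Rightarrow> real) \<Rightarrow> ('a \<Rightarrow> real) set" where
  "H_space V E w \<mu> h = {u \<in> W012_space V E w \<mu>.
     vertex_integrable V \<mu> (\<lambda>x. (grad_norm E w \<mu> u x)\<^sup>2 + h x * (u x)\<^sup>2)}"

end

theory Submission
  imports Defs
begin

text \<open>
  For finite \<open>A \<subseteq> V\<close> the functional
  \<open>J u = 1/2 \<integral>(|\<nabla>u|\<^sup>2 + h u\<^sup>2) + \<integral>f u - ln \<integral>g exp u\<close> is minimised over the functions vanishing
  off \<open>A\<close>. As \<open>\<mu>\<close> and \<open>h\<close> are bounded below, the energy dominates the square of the sup norm while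
  the logarithm grows at most linearly in the sup norm, so that \<open>J u \<le> J 0\<close> bounds both the energy
  and the sup norm of the minimiser \<open>u\<^sub>A\<close> independently of \<open>A\<close>.

  By Tychonoff the \<open>u\<^sub>A\<close> converge pointwise to some \<open>u\<close> along a filter of growing \<open>A\<close>, and
  dominated convergence gives the equation for \<open>u\<close>. That \<open>u\<close> lies in the closure of the finitely
  supported functions needs strong convergence: for \<open>A \<subseteq> A'\<close> the equations express the energy
  of \<open>u\<^sub>A\<^sub>' - u\<^sub>A\<close> through integrals of the right-hand side against \<open>u\<^sub>A\<close> and \<open>u\<^sub>A\<^sub>'\<close>, whose
  limits cancel.
\<close>

section \<open>Unconditional sums\<close>

lemma summable_on_real_bounded_sums:
  fixes f :: "'a \<Rightarrow> real"
  assumes "\<And>x. x \<in> V \<Longrightarrow> f x \<ge> 0" and "\<And>B. finite B \<Longrightarrow> B \<subseteq> V \<Longrightarrow> sum f B \<le> C"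
  shows "f summable_on V"
  using assms by (intro nonneg_bdd_above_summable_on bdd_aboveI2[where M = C]) auto

text \<open>Bounded absolute sums off \<open>A\<close> give absolute summability there, and
  \<open>V\<close> splits into \<open>A\<close> and its complement. Summability is part of the
  conclusion because \<open>infsum\<close> would otherwise take its default value 0.\<close>

lemma infsum_near_finite_sum:
  fixes f :: "'a \<Rightarrow> real"
  assumes A: "finite A" "A \<subseteq> V"
    and tail: "\<And>B. finite B \<Longrightarrow> B \<subseteq> V - A \<Longrightarrow> (\<Sum>x\<in>B. \<bar>f x\<bar>) \<le> e"
  shows "f summable_on V" "\<bar>infsum f V - sum f A\<bar> \<le> e"
proof -
  have abs: "(\<lambda>x. \<bar>f x\<bar>) summable_on (V - A)"
    by (rule summable_on_real_bounded_sums[where C = e]) (use tail in auto)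
  then have sub: "f summable_on (V - A)"
    using summable_on_iff_abs_summable_on_real[of f "V - A"] by simp
  have V: "V = A \<union> (V - A)"
    using A by auto
  show "f summable_on V"
    by (subst V, rule summable_on_Un_disjoint) (use A sub in auto)
  have "infsum f V = sum f A + infsum f (V - A)"
    by (subst V, subst infsum_Un_disjoint) (use A sub in auto)
  moreover have "\<bar>infsum f (V - A)\<bar> \<le> infsum (\<lambda>x. \<bar>f x\<bar>) (V - A)"
    using norm_infsum_bound[of f "V - A"] abs by simp
  moreover have "infsum (\<lambda>x. \<bar>f x\<bar>) (V - A) \<le> e"
    by (rule infsum_le_finite_sums) (use abs tail in auto)
  ultimately show "\<bar>infsum f V - sum f A\<bar> \<le> e"
    by linarith
qed

text \<open>By nonnegativity, appending \<open>B\<close> to a finite set that nearly exhausts the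
  sum cannot overshoot the total.\<close>

lemma summable_on_small_tail:
  fixes b :: "'a \<Rightarrow> real"
  assumes "b summable_on V" "\<And>x. x \<in> V \<Longrightarrow> b x \<ge> 0" "e > 0"
  obtains A where "finite A" "A \<subseteq> V" "\<And>B. finite B \<Longrightarrow> B \<subseteq> V - A \<Longrightarrow> sum b B \<le> e"
proof -
  obtain A where A: "finite A" "A \<subseteq> V" "dist (sum b A) (infsum b V) \<le> e"
    using infsum_finite_approximation[OF assms(1,3)] by blast
  have "sum b B \<le> e" if B: "finite B" "B \<subseteq> V - A" for B
  proof -
    have "sum b (A \<union> B) \<le> infsum b V"
      by (rule finite_sum_le_infsum) (use assms A B in auto)
    moreover have "sum b (A \<union> B) = sum b A + sum b B"
      by (rule sum.union_disjoint) (use A B in auto)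
    ultimately show ?thesis
      using A(3) unfolding dist_real_def by linarith
  qed
  then show thesis
    using that A by blast
qed

text \<open>
  With \<open>c = 0\<close> this is dominated convergence. The terms \<open>c\<close>, whose sums are bounded but need not
  have a common majorant, allow for a product of an \<open>\<ell>\<^sup>2\<close> function with a bounded net in \<open>\<ell>\<^sup>2\<close>.
\<close>

lemma infsum_tendsto_tight:
  fixes \<phi> :: "'i \<Rightarrow> 'a \<Rightarrow> real"
  assumes "F \<noteq> bot"
    and lim: "\<And>x. x \<in> V \<Longrightarrow> ((\<lambda>i. \<phi> i x) \<longlongrightarrow> \<psi> x) F"
    and c_sums: "\<And>i B. finite B \<Longrightarrow> B \<subseteq> V \<Longrightarrow> sum (c i) B \<le> C"
    and dom: "\<And>\<epsilon>. \<epsilon> > 0 \<Longrightarrow> \<exists>b. b summable_on V \<and> (\<forall>x\<in>V. b x \<ge> 0) \<and>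
                (\<forall>\<^sub>F i in F. \<forall>x\<in>V. \<bar>\<phi> i x\<bar> \<le> b x + \<epsilon> * c i x)"
  shows "((\<lambda>i. infsum (\<phi> i) V) \<longlongrightarrow> infsum \<psi> V) F"
proof (rule tendstoI)
  fix e :: real
  assume e: "e > 0"
  have C: "C \<ge> 0"
    using c_sums[of "{}"] by simp
  \<comment> \<open>The majorant and the \<open>c\<close> terms may then each use e/8 of the tail;
    the 1 in \<open>C + 1\<close> covers \<open>C = 0\<close>.\<close>
  define \<epsilon> where "\<epsilon> = e / (8 * (C + 1))"
  have \<epsilon>: "\<epsilon> > 0" "\<epsilon> * C \<le> e / 8"
    using e C by (auto simp: \<epsilon>_def field_simps)
  obtain b where b: "b summable_on V" "\<And>x. x \<in> V \<Longrightarrow> b x \<ge> 0"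
    and ev: "\<forall>\<^sub>F i in F. \<forall>x\<in>V. \<bar>\<phi> i x\<bar> \<le> b x + \<epsilon> * c i x"
    using dom[OF \<epsilon>(1)] by blast
  obtain A where A: "finite A" "A \<subseteq> V"
    and small: "\<And>B. finite B \<Longrightarrow> B \<subseteq> V - A \<Longrightarrow> sum b B \<le> e / 8"
    by (rule summable_on_small_tail[OF b, of "e / 8"]) (use e in auto)
  have tail: "\<forall>\<^sub>F i in F. \<forall>B. finite B \<longrightarrow> B \<subseteq> V - A \<longrightarrow> (\<Sum>x\<in>B. \<bar>\<phi> i x\<bar>) \<le> e / 4"
    using ev
  proof (rule eventually_mono, intro allI impI)
    fix i B
    assume i: "\<forall>x\<in>V. \<bar>\<phi> i x\<bar> \<le> b x + \<epsilon> * c i x" and B: "finite B" "B \<subseteq> V - A"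
    have "(\<Sum>x\<in>B. \<bar>\<phi> i x\<bar>) \<le> (\<Sum>x\<in>B. b x + \<epsilon> * c i x)"
      by (rule sum_mono) (use i B in auto)
    also have "\<dots> = sum b B + \<epsilon> * sum (c i) B"
      by (simp add: sum.distrib sum_distrib_left)
    also have "\<dots> \<le> e / 8 + \<epsilon> * C"
      using small[OF B] c_sums[of B i] B \<epsilon>(1) by (intro add_mono mult_left_mono) auto
    finally show "(\<Sum>x\<in>B. \<bar>\<phi> i x\<bar>) \<le> e / 4"
      using \<epsilon>(2) by linarith
  qed
  \<comment> \<open>The uniform tail bound survives in the limit on each finite set, which also
    makes \<open>\<psi>\<close> summable. The final error is at most three quarters of
    \<open>e\<close>: two tails and the finite part.\<close>
  have tail_lim: "(\<Sum>x\<in>B. \<bar>\<psi> x\<bar>) \<le> e / 4" if B: "finite B" "B \<subseteq> V - A" for B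
  proof (rule tendsto_upperbound[OF _ _ \<open>F \<noteq> bot\<close>])
    show "((\<lambda>i. \<Sum>x\<in>B. \<bar>\<phi> i x\<bar>) \<longlongrightarrow> (\<Sum>x\<in>B. \<bar>\<psi> x\<bar>)) F"
      using B by (intro tendsto_sum tendsto_rabs lim) auto
    show "\<forall>\<^sub>F i in F. (\<Sum>x\<in>B. \<bar>\<phi> i x\<bar>) \<le> e / 4"
      using tail by (rule eventually_mono) (use B in auto)
  qed
  have "((\<lambda>i. sum (\<phi> i) A) \<longlongrightarrow> sum \<psi> A) F"
    using A by (intro tendsto_sum lim) auto
  then have "\<forall>\<^sub>F i in F. dist (sum (\<phi> i) A) (sum \<psi> A) < e / 4"
    using e by (intro tendstoD) auto
  with tail show "\<forall>\<^sub>F i in F. dist (infsum (\<phi> i) V) (infsum \<psi> V) < e"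
  proof eventually_elim
    case (elim i)
    have "\<bar>infsum (\<phi> i) V - sum (\<phi> i) A\<bar> \<le> e / 4"
      by (rule infsum_near_finite_sum) (use A elim in auto)
    moreover have "\<bar>infsum \<psi> V - sum \<psi> A\<bar> \<le> e / 4"
      by (rule infsum_near_finite_sum) (use A tail_lim in auto)
    ultimately show ?case
      using elim(2) e unfolding dist_real_def by linarith
  qed
qed

lemma infsum_tendsto_dominated:
  fixes \<phi> :: "'i \<Rightarrow> 'a \<Rightarrow> real"
  assumes "F \<noteq> bot"
    and "\<And>x. x \<in> V \<Longrightarrow> ((\<lambda>i. \<phi> i x) \<longlongrightarrow> \<psi> x) F"
    and b: "b summable_on V" "\<And>i x. x \<in> V \<Longrightarrow> \<bar>\<phi> i x\<bar> \<le> b x"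
  shows "((\<lambda>i. infsum (\<phi> i) V) \<longlongrightarrow> infsum \<psi> V) F"
proof (rule infsum_tendsto_tight[where c = "\<lambda>_ _. 0" and C = 0])
  have "b x \<ge> 0" if "x \<in> V" for x
    using b(2)[OF that] abs_ge_zero order_trans by blast
  then show "\<exists>b. b summable_on V \<and> (\<forall>x\<in>V. b x \<ge> 0) \<and> (\<forall>\<^sub>F i in F. \<forall>x\<in>V. \<bar>\<phi> i x\<bar> \<le> b x + \<epsilon> * 0)"
    for \<epsilon> :: real
    using b by (intro exI[of _ b]) auto
qed (use assms(1,2) in auto)

text \<open>The difference vanishes off \<open>A\<close>, so it is summable and summability of
  \<open>g\<close> follows. This reduces variations of an infinite sum to finitely many
  coordinates.\<close>

lemma infsum_change_finite:
  fixes f g :: "'a \<Rightarrow> real"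
  assumes A: "finite A" "A \<subseteq> V" and f: "f summable_on V"
    and eq: "\<And>x. x \<in> V - A \<Longrightarrow> g x = f x"
  shows "infsum g V = infsum f V + (\<Sum>x\<in>A. g x - f x)"
proof -
  have "((\<lambda>x. g x - f x) has_sum (\<Sum>x\<in>A. g x - f x)) A"
    using A by simp
  then have "((\<lambda>x. g x - f x) has_sum (\<Sum>x\<in>A. g x - f x)) V"
    by (rule has_sum_cong_neutral[THEN iffD1, rotated -1]) (use A eq in auto)
  from has_sum_add[OF has_sum_infsum[OF f] this]
  have "(g has_sum (infsum f V + (\<Sum>x\<in>A. g x - f x))) V"
    by simp
  then show ?thesis
    by (rule infsumI)
qed

section \<open>Compactness of boxes of functions and cluster points along filters\<close>

lemma compact_fun_box:
  fixes S :: "'a \<Rightarrow> 'b::topological_space set"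
  assumes "\<And>x. compact (S x)"
  shows "compact {u. \<forall>x. u x \<in> S x}"
proof -
  have "compactin (product_topology (\<lambda>_. euclidean) UNIV) (PiE UNIV S)"
    using assms by (simp add: compactin_PiE)
  then show ?thesis
    by (simp add: euclidean_product_topology PiE_UNIV_domain Pi_def)
qed

lemma tendsto_fun_apply:
  fixes u :: "'i \<Rightarrow> 'a \<Rightarrow> 'b::topological_space"
  assumes "(u \<longlongrightarrow> v) F"
  shows "((\<lambda>i. u i x) \<longlongrightarrow> v x) F"
proof -
  have "continuous_on UNIV (\<lambda>u::'a \<Rightarrow> 'b. u x)"
    by simp
  then show ?thesis
    by (rule continuous_on_tendsto_compose[OF _ assms]) auto
qed

text \<open>Takes the place of extracting a convergent subsequence, so that no enumeration of the
  vertices has to be chosen.\<close>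

lemma compact_cluster_filter:
  fixes u :: "'i \<Rightarrow> 'b::topological_space"
  assumes "compact K" "F \<noteq> bot" "\<forall>\<^sub>F i in F. u i \<in> K"
  obtains G v where "G \<le> F" "G \<noteq> bot" "v \<in> K" "(u \<longlongrightarrow> v) G"
proof -
  have "filtermap u F \<noteq> bot" "eventually (\<lambda>x. x \<in> K) (filtermap u F)"
    using assms by (auto simp: filtermap_bot_iff eventually_filtermap)
  then obtain v where v: "v \<in> K" "inf (nhds v) (filtermap u F) \<noteq> bot"
    using assms(1) compact_filter by blast
  \<comment> \<open>Adding the preimages of the neighbourhoods of \<open>v\<close> forces
    convergence; the filter stays proper because \<open>v\<close> is a cluster point.\<close>
  define G where "G = inf (filtercomap u (nhds v)) F"
  have "G \<noteq> bot"
  proof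
    assume "G = bot"
    then have "eventually (\<lambda>_. False) G"
      by simp
    then obtain P Q where PQ: "eventually P (filtercomap u (nhds v))" "eventually Q F"
      "\<And>i. P i \<and> Q i \<longrightarrow> False"
      unfolding G_def eventually_inf by blast
    then obtain R where R: "eventually R (nhds v)" "\<And>i. R (u i) \<Longrightarrow> P i"
      unfolding eventually_filtercomap by blast
    have "eventually (\<lambda>y. \<not> R y) (filtermap u F)"
      unfolding eventually_filtermap using PQ(2) by (rule eventually_mono) (use PQ R in blast)
    with R(1) have "eventually (\<lambda>_. False) (inf (nhds v) (filtermap u F))"
      unfolding eventually_inf by blast
    with v(2) show False
      by (simp add: trivial_limit_def)
  qed
  moreover have "(u \<longlongrightarrow> v) G"
    unfolding G_def filterlim_iff_le_filtercomap by simp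
  ultimately show thesis
    using that[of G v] v(1) by (simp add: G_def)
qed

section \<open>The energy form and finite Dirichlet problems\<close>

text \<open>The working form of the hypotheses: local finiteness becomes finiteness of
  neighbourhoods, and the L^q condition on \<open>f\<close> becomes square summability, which pairs
  well with functions of finite energy.\<close>

locale mean_field_problem = connected_weighted_graph V E w \<mu>
  for V :: "'a set" and E :: "('a \<times> 'a) set" and w :: "'a \<Rightarrow> 'a \<Rightarrow> real" and \<mu> :: "'a \<Rightarrow> real" +
  fixes h g f :: "'a \<Rightarrow> real" and a0 \<mu>0 :: real
  assumes finite_neighbours: "\<And>x. x \<in> V \<Longrightarrow> finite {y. (x, y) \<in> E}"
    and a0_pos: "a0 > 0" and potential_ge: "\<And>x. x \<in> V \<Longrightarrow> h x \<ge> a0"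
    and \<mu>0_pos: "\<mu>0 > 0" and measure_ge: "\<And>x. x \<in> V \<Longrightarrow> \<mu> x \<ge> \<mu>0"
    and g_nonneg: "\<And>x. x \<in> V \<Longrightarrow> g x \<ge> 0" and g_nonzero: "\<exists>x\<in>V. g x \<noteq> 0"
    and g_summable: "(\<lambda>x. \<mu> x * g x) summable_on V"
    and f_square_summable: "(\<lambda>x. \<mu> x * (f x)\<^sup>2) summable_on V"
begin

definition schroedinger :: "('a \<Rightarrow> real) \<Rightarrow> 'a \<Rightarrow> real" where
  "schroedinger u x = - laplacian E w \<mu> u x + h x * u x"

text \<open>The polarised energy, already multiplied by the vertex measure. The factor 1/2
  compensates for each edge occurring in both orientations.\<close>

definition energy_density :: "('a \<Rightarrow> real) \<Rightarrow> ('a \<Rightarrow> real) \<Rightarrow> 'a \<Rightarrow> real" where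
  "energy_density u v x =
     (\<Sum>y | (x, y) \<in> E. w x y * (u y - u x) * (v y - v x)) / 2 + \<mu> x * h x * u x * v x"

text \<open>A function vanishing off \<open>A\<close> has its whole energy on this set, since edges
  leaving \<open>A\<close> still carry some.\<close>

definition closed_nbhd :: "'a set \<Rightarrow> 'a set" where
  "closed_nbhd A = A \<union> (\<Union>x\<in>A. {y. (x, y) \<in> E})"

lemma closed_nbhd:
  assumes "finite A" "A \<subseteq> V"
  shows "finite (closed_nbhd A)" "closed_nbhd A \<subseteq> V" "A \<subseteq> closed_nbhd A"
  using assms finite_neighbours edges_in_verts unfolding closed_nbhd_def by auto

lemma schroedinger_eq:
  assumes "x \<in> V"
  shows "\<mu> x * schroedinger u x = \<mu> x * h x * u x - (\<Sum>y | (x, y) \<in> E. w x y * (u y - u x))"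
  using measure_pos[OF assms] by (simp add: schroedinger_def laplacian_def field_simps)

lemma grad_norm_square:
  assumes "x \<in> V"
  shows "\<mu> x * (grad_norm E w \<mu> u x)\<^sup>2 = (\<Sum>y | (x, y) \<in> E. w x y * (u y - u x)\<^sup>2) / 2"
proof -
  have "(\<Sum>y | (x, y) \<in> E. w x y * (u y - u x)\<^sup>2) \<ge> 0"
    by (rule sum_nonneg) (auto simp: weight_pos less_imp_le)
  then show ?thesis
    using measure_pos[OF assms] by (simp add: grad_norm_def field_simps)
qed

lemma energy_density_self:
  assumes "x \<in> V"
  shows "energy_density u u x = \<mu> x * ((grad_norm E w \<mu> u x)\<^sup>2 + h x * (u x)\<^sup>2)"
proof -
  have "(\<Sum>y | (x, y) \<in> E. w x y * (u y - u x) * (u y - u x)) =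
        (\<Sum>y | (x, y) \<in> E. w x y * (u y - u x)\<^sup>2)"
    by (simp add: power2_eq_square mult.assoc)
  then show ?thesis
    unfolding energy_density_def distrib_left grad_norm_square[OF assms]
    by (simp add: power2_eq_square)
qed

lemma energy_density_ge:
  assumes "x \<in> V"
  shows "energy_density u u x \<ge> a0 * (\<mu> x * (u x)\<^sup>2)" "energy_density u u x \<ge> 0"
proof -
  have \<mu>: "\<mu> x > 0"
    using measure_pos[OF assms] .
  have "a0 * (u x)\<^sup>2 \<le> (grad_norm E w \<mu> u x)\<^sup>2 + h x * (u x)\<^sup>2"
    using potential_ge[OF assms] by (simp add: add_increasing mult_right_mono)
  then have "\<mu> x * (a0 * (u x)\<^sup>2) \<le> energy_density u u x"
    unfolding energy_density_self[OF assms] using \<mu> by (intro mult_left_mono) auto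
  then show *: "energy_density u u x \<ge> a0 * (\<mu> x * (u x)\<^sup>2)"
    by (simp add: mult_ac)
  have "a0 * (\<mu> x * (u x)\<^sup>2) \<ge> 0"
    using \<mu> a0_pos by simp
  with * show "energy_density u u x \<ge> 0"
    by linarith
qed

text \<open>Bilinearity and symmetry of the form. Variable \<open>t\<close> serves the first
  variation, and \<open>t = -1\<close> the energy of a difference.\<close>

lemma energy_density_add_scale:
  "energy_density (\<lambda>z. u z + t * v z) (\<lambda>z. u z + t * v z) x =
     energy_density u u x + 2 * t * energy_density u v x + t\<^sup>2 * energy_density v v x"
proof -
  have "(\<Sum>y | (x, y) \<in> E. w x y * (u y + t * v y - (u x + t * v x)) * (u y + t * v y - (u x + t * v x))) =
    (\<Sum>y | (x, y) \<in> E. w x y * (u y - u x) * (u y - u x))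
    + 2 * t * (\<Sum>y | (x, y) \<in> E. w x y * (u y - u x) * (v y - v x))
    + t\<^sup>2 * (\<Sum>y | (x, y) \<in> E. w x y * (v y - v x) * (v y - v x))"
    unfolding sum_distrib_left sum.distrib[symmetric]
    by (rule sum.cong) (auto simp: algebra_simps power2_eq_square)
  then show ?thesis
    unfolding energy_density_def by (simp add: algebra_simps power2_eq_square)
qed

text \<open>Green's formula; swapping the two orientations of each edge turns one half of the sum into
  the other.\<close>

lemma sum_energy_density:
  assumes A: "A \<subseteq> V" and M: "finite M" "M \<subseteq> V" "closed_nbhd A \<subseteq> M"
    and v: "\<And>x. x \<notin> A \<Longrightarrow> v x = 0"
  shows "(\<Sum>x\<in>M. energy_density u v x) = (\<Sum>x\<in>A. \<mu> x * schroedinger u x * v x)"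
proof -
  define T where "T = (\<Sum>x\<in>A. \<Sum>y | (x, y) \<in> E. w x y * (u y - u x) * v x)"
  have AM: "A \<subseteq> M"
    using M(3) by (auto simp: closed_nbhd_def)
  have fin: "finite {y. (x, y) \<in> E}" if "x \<in> M" for x
    using finite_neighbours that M by auto
  have T1: "(\<Sum>x\<in>M. \<Sum>y | (x, y) \<in> E. w x y * (u y - u x) * v x) = T"
    unfolding T_def by (rule sum.mono_neutral_right) (use M AM v in auto)
  have "(\<Sum>x\<in>M. \<Sum>y | (x, y) \<in> E. w x y * (u y - u x) * v y) =
        (\<Sum>x\<in>M. \<Sum>y\<in>A. if (x, y) \<in> E then w x y * (u y - u x) * v y else 0)"
  proof (rule sum.cong[OF refl])
    fix x assume x: "x \<in> M"
    show "(\<Sum>y | (x, y) \<in> E. w x y * (u y - u x) * v y) =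
          (\<Sum>y\<in>A. if (x, y) \<in> E then w x y * (u y - u x) * v y else 0)"
      by (rule sum.mono_neutral_cong) (use fin[OF x] finite_subset[OF AM M(1)] v in auto)
  qed
  also have "\<dots> = (\<Sum>y\<in>A. \<Sum>x\<in>M. if (x, y) \<in> E then w x y * (u y - u x) * v y else 0)"
    by (rule sum.swap)
  also have "\<dots> = (\<Sum>y\<in>A. \<Sum>x | (y, x) \<in> E. - (w y x * (u x - u y) * v y))"
  proof (rule sum.cong[OF refl])
    fix y assume y: "y \<in> A"
    \<comment> \<open>The inner sum runs over all neighbours of \<open>y\<close> only because
      \<open>M\<close> contains the closed neighbourhood of \<open>A\<close>.\<close>
    have sub: "{x. (y, x) \<in> E} \<subseteq> M"
      using y M(3) by (auto simp: closed_nbhd_def)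
    have sym: "(x, y) \<in> E \<longleftrightarrow> (y, x) \<in> E" for x
      using sym_edges by (meson symE)
    show "(\<Sum>x\<in>M. if (x, y) \<in> E then w x y * (u y - u x) * v y else 0) =
          (\<Sum>x | (y, x) \<in> E. - (w y x * (u x - u y) * v y))"
    proof (rule sum.mono_neutral_cong_right)
      fix x assume "x \<in> {x. (y, x) \<in> E}"
      then show "(if (x, y) \<in> E then w x y * (u y - u x) * v y else 0) = - (w y x * (u x - u y) * v y)"
        using sym weight_sym[of x y] by (simp add: algebra_simps)
    qed (use M sub sym in auto)
  qed
  also have "\<dots> = - T"
    by (simp add: T_def sum_negf)
  finally have T2: "(\<Sum>x\<in>M. \<Sum>y | (x, y) \<in> E. w x y * (u y - u x) * v y) = - T" .
  \<comment> \<open>Both halves contribute \<open>- T\<close>, and the factor 1/2 in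
    \<open>energy_density\<close> leaves a single one.\<close>
  have "(\<Sum>x\<in>M. \<Sum>y | (x, y) \<in> E. w x y * (u y - u x) * (v y - v x)) = - T - T"
    unfolding right_diff_distrib[of _ "v _" "v _"] sum_subtractf T1 T2 ..
  then have "(\<Sum>x\<in>M. energy_density u v x) = (\<Sum>x\<in>M. \<mu> x * h x * u x * v x) - T"
    unfolding energy_density_def sum.distrib by (simp flip: sum_divide_distrib)
  also have "(\<Sum>x\<in>M. \<mu> x * h x * u x * v x) = (\<Sum>x\<in>A. \<mu> x * h x * u x * v x)"
    by (rule sum.mono_neutral_right) (use M AM v in auto)
  also have "(\<Sum>x\<in>A. \<mu> x * h x * u x * v x) - T = (\<Sum>x\<in>A. \<mu> x * schroedinger u x * v x)"
    unfolding T_def sum_subtractf[symmetric]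
  proof (rule sum.cong[OF refl])
    fix x assume "x \<in> A"
    then have x: "x \<in> V"
      using A by auto
    have "\<mu> x * schroedinger u x * v x =
          \<mu> x * h x * u x * v x - (\<Sum>y | (x, y) \<in> E. w x y * (u y - u x)) * v x"
      unfolding schroedinger_eq[OF x] by (simp add: left_diff_distrib)
    then show "\<mu> x * h x * u x * v x - (\<Sum>y | (x, y) \<in> E. w x y * (u y - u x) * v x) =
          \<mu> x * schroedinger u x * v x"
      by (simp add: sum_distrib_right)
  qed
  finally show ?thesis .
qed

text \<open>Densities are nonnegative, so \<open>B\<close> may be enlarged until Green's formula is
  exact.\<close>

lemma sum_energy_density_le:
  assumes A: "finite A" "A \<subseteq> V" and B: "finite B" "B \<subseteq> V" and u: "\<And>x. x \<notin> A \<Longrightarrow> u x = 0"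
  shows "(\<Sum>x\<in>B. energy_density u u x) \<le> (\<Sum>x\<in>A. \<mu> x * schroedinger u x * u x)"
proof -
  note N = closed_nbhd[OF A]
  have "(\<Sum>x\<in>B. energy_density u u x) \<le> (\<Sum>x\<in>B \<union> closed_nbhd A. energy_density u u x)"
    by (rule sum_mono2) (use B N energy_density_ge in auto)
  also have "\<dots> = (\<Sum>x\<in>A. \<mu> x * schroedinger u x * u x)"
    by (rule sum_energy_density) (use A B N u in auto)
  finally show ?thesis .
qed

section \<open>The partition function\<close>

definition partition_fn :: "('a \<Rightarrow> real) \<Rightarrow> real" where
  "partition_fn u = vertex_integral V \<mu> (\<lambda>y. g y * exp (u y))"

lemma partition_fn_eq: "partition_fn u = (\<Sum>\<^sub>\<infinity>x\<in>V. \<mu> x * g x * exp (u x))"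
  by (simp add: partition_fn_def vertex_integral_def mult.assoc)

lemma g_weight_nonneg: "x \<in> V \<Longrightarrow> \<mu> x * g x \<ge> 0"
  using measure_pos[of x] g_nonneg[of x] by simp

lemma partition_fn_summable:
  assumes "\<And>x. x \<in> V \<Longrightarrow> u x \<le> m"
  shows "(\<lambda>x. \<mu> x * g x * exp (u x)) summable_on V"
proof (rule summable_on_comparison_test)
  show "(\<lambda>x. \<mu> x * g x * exp m) summable_on V"
    using g_summable by (rule summable_on_cmult_left)
qed (use assms g_weight_nonneg in \<open>auto intro: mult_left_mono\<close>)

lemma partition_fn_mono:
  assumes "\<And>x. x \<in> V \<Longrightarrow> u x \<le> v x" and "\<And>x. x \<in> V \<Longrightarrow> v x \<le> m"
  shows "partition_fn u \<le> partition_fn v"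
  unfolding partition_fn_eq
proof (rule infsum_mono)
  have "u x \<le> m" if "x \<in> V" for x
    using assms that by (meson order_trans)
  then show "(\<lambda>x. \<mu> x * g x * exp (u x)) summable_on V"
    by (rule partition_fn_summable)
  show "(\<lambda>x. \<mu> x * g x * exp (v x)) summable_on V"
    by (rule partition_fn_summable) (rule assms)
qed (use assms g_weight_nonneg in \<open>auto intro: mult_left_mono\<close>)

lemma partition_fn_const: "partition_fn (\<lambda>_. m) = exp m * partition_fn (\<lambda>_. 0)"
  unfolding partition_fn_eq by (simp add: infsum_cmult_left')

lemma partition_fn_zero_pos: "partition_fn (\<lambda>_. 0) > 0"
proof -
  obtain x where x: "x \<in> V" "g x \<noteq> 0"
    using g_nonzero by blast
  then have "0 < \<mu> x * g x"
    using g_nonneg[of x] measure_pos[of x] by simp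
  also have "\<mu> x * g x = sum (\<lambda>x. \<mu> x * g x) {x}"
    by simp
  also have "\<dots> \<le> partition_fn (\<lambda>_. 0)"
    unfolding partition_fn_eq exp_zero mult_1_right
    by (rule finite_sum_le_infsum) (use g_summable x g_weight_nonneg in auto)
  finally show ?thesis .
qed

text \<open>Comparison with the constants \<open>m\<close> and \<open>- m\<close>. The bounds depend
  on \<open>u\<close> only through \<open>m\<close>, which keeps the denominators uniformly away
  from 0.\<close>

lemma partition_fn_bounds:
  assumes "\<And>x. x \<in> V \<Longrightarrow> \<bar>u x\<bar> \<le> m"
  shows "exp (- m) * partition_fn (\<lambda>_. 0) \<le> partition_fn u"
    and "partition_fn u \<le> exp m * partition_fn (\<lambda>_. 0)"
    and "partition_fn u > 0"
proof -
  have m: "- m \<le> u x" "u x \<le> m" if "x \<in> V" for x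
    using assms[OF that] by auto
  have "partition_fn (\<lambda>_. - m) \<le> partition_fn u"
    by (rule partition_fn_mono[where m = m]) (use m in auto)
  then show 1: "exp (- m) * partition_fn (\<lambda>_. 0) \<le> partition_fn u"
    by (simp only: partition_fn_const[of "- m"])
  have "partition_fn u \<le> partition_fn (\<lambda>_. m)"
    by (rule partition_fn_mono[where m = m]) (use m in auto)
  then show "partition_fn u \<le> exp m * partition_fn (\<lambda>_. 0)"
    by (simp only: partition_fn_const[of m])
  have "0 < exp (- m) * partition_fn (\<lambda>_. 0)"
    using partition_fn_zero_pos by simp
  with 1 show "partition_fn u > 0"
    by linarith
qed

text \<open>Turns the dependence on the values in \<open>A\<close> into a finite sum, so continuity
  and derivatives need no exchange of limits.\<close>

lemma partition_fn_change:
  assumes A: "finite A" "A \<subseteq> V" and u: "\<And>x. x \<in> V \<Longrightarrow> u x \<le> m"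
    and eq: "\<And>x. x \<in> V - A \<Longrightarrow> v x = u x"
  shows "partition_fn v = partition_fn u + (\<Sum>x\<in>A. \<mu> x * g x * (exp (v x) - exp (u x)))"
  unfolding partition_fn_eq right_diff_distrib
  by (rule infsum_change_finite) (use A eq partition_fn_summable[OF u] in auto)

section \<open>The variational functional and its coercivity\<close>

definition functional :: "'a set \<Rightarrow> ('a \<Rightarrow> real) \<Rightarrow> real" where
  "functional A u = (\<Sum>x\<in>closed_nbhd A. energy_density u u x) / 2
     + (\<Sum>x\<in>A. \<mu> x * f x * u x) - ln (partition_fn u)"

text \<open>The constant left by the absorption in \<open>functional_coercive\<close>: of half the
  energy \<open>Q\<close>, the parts Q/4 and Q/8 are used up, and the remaining Q/8 explains the
  factor 8.\<close>

definition energy_bound :: real where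
  "energy_bound = 8 * ((\<Sum>\<^sub>\<infinity>x\<in>V. \<mu> x * (f x)\<^sup>2) / a0 + 2 / (\<mu>0 * a0))"

text \<open>The added 1 makes the bound on minimisers strict. It also gives \<open>sup_bound\<close>
  at most its own square, which avoids a square root.\<close>

definition sup_bound :: real where
  "sup_bound = energy_bound / (\<mu>0 * a0) + 1"

lemma square_le_energy:
  assumes "finite B" "B \<subseteq> V" "x \<in> B"
  shows "\<mu>0 * a0 * (u x)\<^sup>2 \<le> (\<Sum>x\<in>B. energy_density u u x)"
proof -
  have x: "x \<in> V"
    using assms by auto
  have "\<mu>0 * a0 * (u x)\<^sup>2 \<le> a0 * (\<mu> x * (u x)\<^sup>2)"
    using measure_ge[OF x] a0_pos by (simp add: mult_right_mono mult.commute)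
  also have "\<dots> \<le> energy_density u u x"
    using energy_density_ge x by blast
  also have "\<dots> \<le> (\<Sum>x\<in>B. energy_density u u x)"
    by (rule member_le_sum) (use assms energy_density_ge in auto)
  finally show ?thesis .
qed

lemma energy_bound_nonneg: "energy_bound \<ge> 0"
proof -
  have "(\<Sum>\<^sub>\<infinity>x\<in>V. \<mu> x * (f x)\<^sup>2) \<ge> 0"
    by (rule infsum_nonneg) (use measure_pos in \<open>auto simp: less_imp_le\<close>)
  then show ?thesis
    unfolding energy_bound_def using a0_pos \<mu>0_pos by simp
qed

lemma sup_bound_ge: "sup_bound \<ge> 1"
  unfolding sup_bound_def using energy_bound_nonneg a0_pos \<mu>0_pos by simp

lemma abs_less_sup_bound:
  assumes "\<mu>0 * a0 * s\<^sup>2 \<le> energy_bound"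
  shows "\<bar>s\<bar> < sup_bound"
proof -
  have c: "\<mu>0 * a0 > 0"
    using \<mu>0_pos a0_pos by simp
  have "s\<^sup>2 \<le> energy_bound / (\<mu>0 * a0)"
    using assms c by (simp add: field_simps)
  also have "\<dots> < sup_bound"
    by (simp add: sup_bound_def)
  also have "\<dots> \<le> sup_bound\<^sup>2"
    using sup_bound_ge by (simp add: power2_eq_square)
  finally have "\<bar>s\<bar>\<^sup>2 < sup_bound\<^sup>2"
    by simp
  then show ?thesis
    using sup_bound_ge by (meson power_less_imp_less_base order_trans zero_le_one)
qed

text \<open>Comparison with the zero function. The logarithm is at most linear in the sup norm and
  \<open>f\<close> enters linearly, so small multiples of the energy absorb both.\<close>

lemma functional_coercive:
  assumes A: "finite A" "A \<subseteq> V" and u: "\<And>x. x \<notin> A \<Longrightarrow> u x = 0"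
    and le: "functional A u \<le> functional A (\<lambda>_. 0)"
  shows "(\<Sum>x\<in>closed_nbhd A. energy_density u u x) \<le> energy_bound"
proof -
  note N = closed_nbhd[OF A]
  define Q where "Q = (\<Sum>x\<in>closed_nbhd A. energy_density u u x)"
  define c where "c = \<mu>0 * a0"
  define F where "F = (\<Sum>\<^sub>\<infinity>x\<in>V. \<mu> x * (f x)\<^sup>2)"
  have c: "c > 0"
    using \<mu>0_pos a0_pos by (simp add: c_def)
  have Q: "Q \<ge> 0"
    unfolding Q_def by (rule sum_nonneg) (use N energy_density_ge in auto)
  have sup: "\<bar>u x\<bar> \<le> Q / 8 + 2 / c" for x
  proof (cases "x \<in> A")
    case True
    have "c * (u x)\<^sup>2 \<le> Q"
      unfolding c_def Q_def by (rule square_le_energy) (use N True in auto)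
    moreover have "\<bar>u x\<bar> \<le> c * (u x)\<^sup>2 / 8 + 2 / c"
    proof -
      \<comment> \<open>Completing the square with 4 yields exactly the coefficients 1/8 and
        2/c.\<close>
      have "0 \<le> (c * \<bar>u x\<bar> - 4)\<^sup>2"
        by simp
      also have "\<dots> = c\<^sup>2 * (u x)\<^sup>2 - 8 * c * \<bar>u x\<bar> + 16"
        by (simp add: power2_diff power_mult_distrib)
      finally have "8 * c * \<bar>u x\<bar> \<le> c\<^sup>2 * (u x)\<^sup>2 + 16"
        by simp
      then show ?thesis
        using c by (simp add: field_simps power2_eq_square)
    qed
    ultimately show ?thesis
      by linarith
  qed (use u Q c in simp)
  have "ln (partition_fn u) \<le> ln (exp (Q / 8 + 2 / c) * partition_fn (\<lambda>_. 0))"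
    using partition_fn_bounds[of u "Q / 8 + 2 / c"] sup by (intro ln_mono) auto
  also have "\<dots> = Q / 8 + 2 / c + ln (partition_fn (\<lambda>_. 0))"
    using partition_fn_zero_pos by (simp add: ln_mult)
  finally have ln_le: "ln (partition_fn u) \<le> Q / 8 + 2 / c + ln (partition_fn (\<lambda>_. 0))" .
  have "- (\<Sum>x\<in>A. \<mu> x * f x * u x) \<le> (\<Sum>x\<in>A. \<mu> x * (f x)\<^sup>2 / a0 + a0 * (\<mu> x * (u x)\<^sup>2) / 4)"
    unfolding sum_negf[symmetric]
  proof (rule sum_mono)
    fix x assume "x \<in> A"
    then have \<mu>: "\<mu> x > 0"
      using A measure_pos by auto
    \<comment> \<open>Young's inequality, weighted so that the part in \<open>u\<close> is a quarter
      of the lower bound in \<open>energy_density_ge\<close>.\<close>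
    have "0 \<le> \<mu> x * (2 * f x + a0 * u x)\<^sup>2 / (4 * a0)"
      using \<mu> a0_pos by simp
    also have "\<dots> = \<mu> x * (f x)\<^sup>2 / a0 + a0 * (\<mu> x * (u x)\<^sup>2) / 4 + \<mu> x * f x * u x"
      using a0_pos by (simp add: field_simps power2_eq_square)
    finally show "- (\<mu> x * f x * u x) \<le> \<mu> x * (f x)\<^sup>2 / a0 + a0 * (\<mu> x * (u x)\<^sup>2) / 4"
      by linarith
  qed
  also have "\<dots> = (\<Sum>x\<in>A. \<mu> x * (f x)\<^sup>2) / a0 + (\<Sum>x\<in>A. a0 * (\<mu> x * (u x)\<^sup>2)) / 4"
    by (simp add: sum.distrib sum_divide_distrib)
  also have "\<dots> \<le> F / a0 + Q / 4"
  proof (intro add_mono divide_right_mono)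
    show "(\<Sum>x\<in>A. \<mu> x * (f x)\<^sup>2) \<le> F"
      unfolding F_def by (rule finite_sum_le_infsum)
        (use A f_square_summable measure_pos in \<open>auto simp: less_imp_le\<close>)
    have "(\<Sum>x\<in>A. a0 * (\<mu> x * (u x)\<^sup>2)) \<le> (\<Sum>x\<in>A. energy_density u u x)"
      by (rule sum_mono) (use A energy_density_ge in auto)
    also have "\<dots> \<le> Q"
      unfolding Q_def by (rule sum_mono2) (use N energy_density_ge in auto)
    finally show "(\<Sum>x\<in>A. a0 * (\<mu> x * (u x)\<^sup>2)) \<le> Q" .
  qed (use a0_pos in auto)
  finally have f_le: "- (\<Sum>x\<in>A. \<mu> x * f x * u x) \<le> F / a0 + Q / 4" .
  have "Q / 2 + (\<Sum>x\<in>A. \<mu> x * f x * u x) - ln (partition_fn u) \<le> - ln (partition_fn (\<lambda>_. 0))"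
    using le by (simp add: functional_def Q_def energy_density_def)
  with ln_le f_le have "Q \<le> 8 * (F / a0 + 2 / c)"
    by simp
  then show ?thesis
    by (simp add: Q_def F_def c_def energy_bound_def)
qed

section \<open>Minimisers and the finite Dirichlet problem\<close>

definition rhs :: "('a \<Rightarrow> real) \<Rightarrow> 'a \<Rightarrow> real" where
  "rhs u x = g x * exp (u x) / partition_fn u - f x"

text \<open>Bounds independent of the finite set. Stated through finite sums, they pass to pointwise
  limits before any summability is known.\<close>

definition admissible :: "('a \<Rightarrow> real) \<Rightarrow> bool" where
  "admissible u \<longleftrightarrow> (\<forall>x. \<bar>u x\<bar> \<le> sup_bound) \<and>
     (\<forall>B. finite B \<longrightarrow> B \<subseteq> V \<longrightarrow> (\<Sum>x\<in>B. energy_density u u x) \<le> energy_bound)"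

definition dirichlet_solution :: "'a set \<Rightarrow> ('a \<Rightarrow> real) \<Rightarrow> bool" where
  "dirichlet_solution A u \<longleftrightarrow> (\<forall>x. x \<notin> A \<longrightarrow> u x = 0) \<and> (\<forall>x\<in>A. schroedinger u x = rhs u x)"

text \<open>A product of compact sets over the whole type, ready for Tychonoff. The bound is an
  artificial constraint that turns out to be inactive at a minimiser.\<close>

definition dirichlet_box :: "'a set \<Rightarrow> ('a \<Rightarrow> real) set" where
  "dirichlet_box A = {u. \<forall>x. u x \<in> (if x \<in> A then {- sup_bound..sup_bound} else {0})}"

lemma dirichlet_box_iff:
  "u \<in> dirichlet_box A \<longleftrightarrow> (\<forall>x. \<bar>u x\<bar> \<le> sup_bound) \<and> (\<forall>x. x \<notin> A \<longrightarrow> u x = 0)"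
proof -
  have "u x \<in> (if x \<in> A then {- sup_bound..sup_bound} else {0}) \<longleftrightarrow>
        \<bar>u x\<bar> \<le> sup_bound \<and> (x \<notin> A \<longrightarrow> u x = 0)" for x
    using sup_bound_ge by auto
  then show ?thesis
    unfolding dirichlet_box_def by blast
qed

lemma compact_dirichlet_box: "compact (dirichlet_box A)"
  unfolding dirichlet_box_def by (rule compact_fun_box) auto

text \<open>On the box only the coordinates in \<open>A\<close> vary, so the partition function is a
  constant plus a finite sum of exponentials.\<close>

lemma continuous_on_functional:
  assumes A: "finite A" "A \<subseteq> V"
  shows "continuous_on (dirichlet_box A) (functional A)"
proof -
  have coord [continuous_intros]: "continuous_on (dirichlet_box A) (\<lambda>u. u x)" for x
    by (rule continuous_on_subset[OF continuous_on_product_coordinates]) auto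
  have eq: "partition_fn u = partition_fn (\<lambda>_. 0) + (\<Sum>x\<in>A. \<mu> x * g x * (exp (u x) - exp 0))"
    if "u \<in> dirichlet_box A" for u
    by (rule partition_fn_change[where m = 0]) (use A that in \<open>auto simp: dirichlet_box_iff\<close>)
  have "continuous_on (dirichlet_box A)
      (\<lambda>u. partition_fn (\<lambda>_. 0) + (\<Sum>x\<in>A. \<mu> x * g x * (exp (u x) - exp 0)))"
    by (intro continuous_intros)
  then have cont: "continuous_on (dirichlet_box A) partition_fn"
    by (rule continuous_on_cong[THEN iffD2, rotated -1]) (use eq in auto)
  have "partition_fn u \<noteq> 0" if "u \<in> dirichlet_box A" for u
    using partition_fn_bounds(3)[of u sup_bound] that by (auto simp: dirichlet_box_iff)
  then show ?thesis
    unfolding functional_def energy_density_def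
    by (intro continuous_intros cont) auto
qed

text \<open>Varying \<open>u\<close> at the single vertex \<open>x\<close> stays inside the box for
  small \<open>t\<close>, so the derivative of a function of one real variable vanishes.\<close>

lemma minimizer_euler_lagrange:
  assumes A: "finite A" "A \<subseteq> V" and u: "u \<in> dirichlet_box A"
    and min: "\<And>v. v \<in> dirichlet_box A \<Longrightarrow> functional A u \<le> functional A v"
    and x: "x \<in> A" and strict: "\<bar>u x\<bar> < sup_bound"
  shows "schroedinger u x = rhs u x"
proof -
  note N = closed_nbhd[OF A]
  define \<delta> :: "'a \<Rightarrow> real" where "\<delta> z = (if z = x then 1 else 0)" for z
  define v where "v t z = u z + t * \<delta> z" for t z
  define Q where "Q = (\<Sum>z\<in>closed_nbhd A. energy_density u u z)"
  define D where "D = (\<Sum>z\<in>closed_nbhd A. energy_density \<delta> \<delta> z)"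
  define Z where "Z = partition_fn u"
  define \<gamma> where "\<gamma> = \<mu> x * g x * exp (u x)"
  \<comment> \<open>The functional along the variation: Green's formula supplies the term linear in
    \<open>t\<close>, and only the summand at \<open>x\<close> changes in the partition
    function.\<close>
  define \<theta> where "\<theta> t = (Q + 2 * t * (\<mu> x * schroedinger u x) + t\<^sup>2 * D) / 2
    + ((\<Sum>z\<in>A. \<mu> z * f z * u z) + t * (\<mu> x * f x)) - ln (Z + \<gamma> * (exp t - 1))" for t
  have xV: "x \<in> V"
    using A x by auto
  have ub: "u z \<le> sup_bound" for z
    using u by (auto simp: dirichlet_box_iff abs_le_iff)
  have Z: "Z > 0"
    unfolding Z_def using partition_fn_bounds(3)[of u sup_bound] u by (auto simp: dirichlet_box_iff)
  have "(\<Sum>z\<in>closed_nbhd A. energy_density u \<delta> z) = (\<Sum>z\<in>A. \<mu> z * schroedinger u z * \<delta> z)"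
    by (rule sum_energy_density) (use A N x in \<open>auto simp: \<delta>_def\<close>)
  also have "\<dots> = \<mu> x * schroedinger u x"
    using A x by (simp add: \<delta>_def if_distrib[of "(*) _"] sum.delta cong: if_cong)
  finally have B: "(\<Sum>z\<in>closed_nbhd A. energy_density u \<delta> z) = \<mu> x * schroedinger u x" .
  have \<theta>: "functional A (v t) = \<theta> t" for t
  proof -
    have "(\<Sum>z\<in>closed_nbhd A. energy_density (v t) (v t) z) =
          Q + 2 * t * (\<mu> x * schroedinger u x) + t\<^sup>2 * D"
      unfolding v_def energy_density_add_scale sum.distrib sum_distrib_left[symmetric] B
      by (simp add: Q_def D_def)
    moreover have "(\<Sum>z\<in>A. \<mu> z * f z * v t z) = (\<Sum>z\<in>A. \<mu> z * f z * u z) + t * (\<mu> x * f x)"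
    proof -
      have "(\<Sum>z\<in>A. \<mu> z * f z * v t z) =
            (\<Sum>z\<in>A. \<mu> z * f z * u z) + (\<Sum>z\<in>A. if z = x then t * (\<mu> z * f z) else 0)"
        unfolding sum.distrib[symmetric] by (rule sum.cong) (auto simp: v_def \<delta>_def algebra_simps)
      then show ?thesis
        using A x by simp
    qed
    moreover have "partition_fn (v t) = Z + \<gamma> * (exp t - 1)"
    proof -
      have "partition_fn (v t) = Z + (\<Sum>z\<in>{x}. \<mu> z * g z * (exp (v t z) - exp (u z)))"
        unfolding Z_def
        by (rule partition_fn_change[where m = sup_bound]) (use xV ub in \<open>auto simp: v_def \<delta>_def\<close>)
      then show ?thesis
        by (simp add: v_def \<delta>_def \<gamma>_def exp_add algebra_simps)
    qed
    ultimately show ?thesis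
      unfolding functional_def \<theta>_def by simp
  qed
  have v0: "v 0 = u"
    by (simp add: v_def fun_eq_iff)
  have "\<theta> 0 \<le> \<theta> t" if t: "\<bar>0 - t\<bar> < sup_bound - \<bar>u x\<bar>" for t
  proof -
    have "v t \<in> dirichlet_box A"
      using u t x unfolding dirichlet_box_iff v_def \<delta>_def by auto
    then show ?thesis
      using min \<theta> v0 by metis
  qed
  moreover have "(\<theta> has_real_derivative
      (\<mu> x * schroedinger u x + \<mu> x * f x - \<gamma> / Z)) (at 0)"
    unfolding \<theta>_def using Z by (auto intro!: derivative_eq_intros simp: field_simps)
  ultimately have "\<mu> x * schroedinger u x + \<mu> x * f x - \<gamma> / Z = 0"
    using strict by (intro DERIV_local_min[of \<theta> _ 0 "sup_bound - \<bar>u x\<bar>"]) auto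
  then have "\<mu> x * schroedinger u x = \<mu> x * rhs u x"
    by (simp add: rhs_def \<gamma>_def Z_def algebra_simps)
  then show ?thesis
    using measure_pos[OF xV] by simp
qed

lemma dirichlet_solution_exists:
  assumes A: "finite A" "A \<subseteq> V"
  obtains u where "admissible u" "dirichlet_solution A u"
proof -
  note N = closed_nbhd[OF A]
  have zero: "(\<lambda>_. 0) \<in> dirichlet_box A"
    using sup_bound_ge by (simp add: dirichlet_box_iff)
  then obtain u where u: "u \<in> dirichlet_box A"
    and min: "\<And>v. v \<in> dirichlet_box A \<Longrightarrow> functional A u \<le> functional A v"
    using continuous_attains_inf[OF compact_dirichlet_box _ continuous_on_functional[OF A]] by blast
  have off: "u x = 0" if "x \<notin> A" for x
    using u that by (simp add: dirichlet_box_iff)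
  have le: "(\<Sum>x\<in>closed_nbhd A. energy_density u u x) \<le> energy_bound"
    using functional_coercive[OF A] off min[OF zero] by blast
  \<comment> \<open>The energy bound keeps the minimiser off the walls of the box, which frees it
    for the variation at every vertex of \<open>A\<close>.\<close>
  have strict: "\<bar>u x\<bar> < sup_bound" if "x \<in> A" for x
  proof (rule abs_less_sup_bound)
    show "\<mu>0 * a0 * (u x)\<^sup>2 \<le> energy_bound"
      using square_le_energy[OF N(1,2), of x u] N(3) that le by fastforce
  qed
  have sol: "dirichlet_solution A u"
    unfolding dirichlet_solution_def using minimizer_euler_lagrange[OF A u min] strict off by blast
  have "(\<Sum>x\<in>B. energy_density u u x) \<le> energy_bound" if B: "finite B" "B \<subseteq> V" for B
  proof -
    have "(\<Sum>x\<in>B. energy_density u u x) \<le> (\<Sum>x\<in>A. \<mu> x * schroedinger u x * u x)"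
      by (rule sum_energy_density_le) (use A B off in auto)
    also have "\<dots> = (\<Sum>x\<in>closed_nbhd A. energy_density u u x)"
      by (rule sum_energy_density[symmetric]) (use A N off in auto)
    finally show ?thesis
      using le by linarith
  qed
  then have "admissible u"
    using u by (auto simp: admissible_def dirichlet_box_iff)
  with sol show thesis
    using that by blast
qed

subsection \<open>Passage to the limit\<close>

text \<open>The right-hand side tested against \<open>v\<close>. For a Dirichlet solution
  \<open>a\<close> on \<open>A\<close> and \<open>v\<close> vanishing off \<open>A\<close> it is the
  energy form of \<open>a\<close> and \<open>v\<close>.\<close>

definition pairing :: "('a \<Rightarrow> real) \<Rightarrow> ('a \<Rightarrow> real) \<Rightarrow> real" where
  "pairing a v = (\<Sum>\<^sub>\<infinity>x\<in>V. \<mu> x * rhs a x * v x)"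

lemma admissible_zero: "admissible (\<lambda>_. 0)"
  using sup_bound_ge energy_bound_nonneg by (simp add: admissible_def energy_density_def)

lemma admissible_abs_le: "admissible u \<Longrightarrow> \<bar>u x\<bar> \<le> sup_bound"
  by (simp add: admissible_def)

lemma partition_fn_pos: "admissible u \<Longrightarrow> partition_fn u > 0"
  using partition_fn_bounds(3)[of u sup_bound] by (simp add: admissible_def)

lemma pairing_finite_support:
  assumes A: "finite A" "A \<subseteq> V" "\<And>x. x \<notin> A \<Longrightarrow> v x = 0"
  shows "pairing a v = (\<Sum>x\<in>A. \<mu> x * rhs a x * v x)"
proof -
  have "pairing a v = (\<Sum>\<^sub>\<infinity>x\<in>A. \<mu> x * rhs a x * v x)"
    unfolding pairing_def by (rule infsum_cong_neutral) (use A in auto)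
  then show ?thesis
    using A by simp
qed

lemma energy_density_tendsto:
  assumes "\<And>x. ((\<lambda>i. u i x) \<longlongrightarrow> v x) F"
  shows "((\<lambda>i. energy_density (u i) (u i) x) \<longlongrightarrow> energy_density v v x) F"
  unfolding energy_density_def by (intro tendsto_intros assms) auto

lemma admissible_limit:
  assumes "F \<noteq> bot" and lim: "\<And>x. ((\<lambda>i. u i x) \<longlongrightarrow> v x) F" and u: "\<And>i. admissible (u i)"
  shows "admissible v"
  unfolding admissible_def
proof (intro conjI allI impI)
  fix x
  show "\<bar>v x\<bar> \<le> sup_bound"
    using tendsto_rabs[OF lim[of x]] \<open>F \<noteq> bot\<close> admissible_abs_le[OF u]
    by (intro tendsto_upperbound[of _ _ F]) auto
next
  fix B assume B: "finite B" "B \<subseteq> V"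
  show "(\<Sum>x\<in>B. energy_density v v x) \<le> energy_bound"
  proof (rule tendsto_upperbound[OF _ _ \<open>F \<noteq> bot\<close>])
    show "((\<lambda>i. \<Sum>x\<in>B. energy_density (u i) (u i) x) \<longlongrightarrow> (\<Sum>x\<in>B. energy_density v v x)) F"
      by (intro tendsto_sum energy_density_tendsto lim)
  qed (use u B in \<open>auto simp: admissible_def\<close>)
qed

lemma partition_fn_tendsto:
  assumes "F \<noteq> bot" and lim: "\<And>x. ((\<lambda>i. u i x) \<longlongrightarrow> v x) F" and u: "\<And>i. admissible (u i)"
  shows "((\<lambda>i. partition_fn (u i)) \<longlongrightarrow> partition_fn v) F"
  unfolding partition_fn_eq
proof (rule infsum_tendsto_dominated[OF \<open>F \<noteq> bot\<close>])
  show "(\<lambda>x. \<mu> x * g x * exp sup_bound) summable_on V"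
    using g_summable by (rule summable_on_cmult_left)
  fix i x assume x: "x \<in> V"
  have "\<mu> x * g x * exp (u i x) \<le> \<mu> x * g x * exp sup_bound"
    using g_weight_nonneg[OF x] admissible_abs_le[OF u, of i x] by (intro mult_left_mono) auto
  then show "\<bar>\<mu> x * g x * exp (u i x)\<bar> \<le> \<mu> x * g x * exp sup_bound"
    using g_nonneg[OF x] measure_pos[OF x] by (simp add: abs_mult)
qed (intro tendsto_intros lim)

lemma rhs_tendsto:
  assumes "F \<noteq> bot" and lim: "\<And>x. ((\<lambda>i. u i x) \<longlongrightarrow> v x) F" and u: "\<And>i. admissible (u i)"
  shows "((\<lambda>i. rhs (u i) x) \<longlongrightarrow> rhs v x) F"
  unfolding rhs_def
  using partition_fn_pos[OF admissible_limit[OF assms]]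
  by (intro tendsto_intros lim partition_fn_tendsto assms) auto

text \<open>The exponential part has a fixed multiple of \<open>g\<close> as majorant; the
  \<open>f\<close> part is split with a free \<epsilon>. This is the shape that
  \<open>infsum_tendsto_tight\<close> takes.\<close>

lemma abs_rhs_mult_le:
  assumes x: "x \<in> V" and a: "admissible a" and v: "admissible v" and \<epsilon>: "\<epsilon> > 0"
  shows "\<bar>\<mu> x * rhs a x * v x\<bar> \<le>
    \<mu> x * g x * (exp sup_bound / (exp (- sup_bound) * partition_fn (\<lambda>_. 0)) * sup_bound)
    + \<mu> x * (f x)\<^sup>2 * (1 / (4 * \<epsilon>)) + \<epsilon> * (\<mu> x * (v x)\<^sup>2)"
proof -
  define Z0 where "Z0 = exp (- sup_bound) * partition_fn (\<lambda>_. 0)"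
  have \<mu>: "\<mu> x > 0"
    using measure_pos[OF x] .
  have Z: "Z0 > 0" "Z0 \<le> partition_fn a"
    using partition_fn_zero_pos partition_fn_bounds(1)[of a sup_bound] admissible_abs_le[OF a]
    by (auto simp: Z0_def)
  have "exp (a x) / partition_fn a \<le> exp sup_bound / Z0"
    using Z admissible_abs_le[OF a, of x] by (intro frac_le) auto
  moreover have "exp (a x) / partition_fn a \<ge> 0"
    using Z by simp
  ultimately have "exp (a x) / partition_fn a * \<bar>v x\<bar> \<le> exp sup_bound / Z0 * sup_bound"
    using admissible_abs_le[OF v, of x] by (intro mult_mono) auto
  then have G: "\<mu> x * g x * (exp (a x) / partition_fn a * \<bar>v x\<bar>) \<le>
      \<mu> x * g x * (exp sup_bound / Z0 * sup_bound)"
    using g_weight_nonneg[OF x] by (intro mult_left_mono)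
  \<comment> \<open>Young's inequality with the large factor on the fixed \<open>f\<close> and the
    small one on the varying \<open>v\<close>.\<close>
  have "0 \<le> \<mu> x * (\<bar>f x\<bar> - 2 * \<epsilon> * \<bar>v x\<bar>)\<^sup>2 / (4 * \<epsilon>)"
    using \<mu> \<epsilon> by simp
  also have "\<dots> = \<mu> x * (f x)\<^sup>2 * (1 / (4 * \<epsilon>)) + \<epsilon> * (\<mu> x * (v x)\<^sup>2) - \<mu> x * \<bar>f x\<bar> * \<bar>v x\<bar>"
    using \<epsilon> by (simp add: power2_diff power_mult_distrib) (simp add: field_simps power2_eq_square)
  finally have Fv: "\<mu> x * \<bar>f x\<bar> * \<bar>v x\<bar> \<le> \<mu> x * (f x)\<^sup>2 * (1 / (4 * \<epsilon>)) + \<epsilon> * (\<mu> x * (v x)\<^sup>2)"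
    by linarith
  have "\<mu> x * rhs a x * v x =
      \<mu> x * g x * (exp (a x) / partition_fn a * v x) - \<mu> x * f x * v x"
    by (simp add: rhs_def algebra_simps)
  also have "\<bar>\<dots>\<bar> \<le> \<bar>\<mu> x * g x * (exp (a x) / partition_fn a * v x)\<bar> + \<bar>\<mu> x * f x * v x\<bar>"
    by (rule abs_triangle_ineq4)
  also have "\<dots> = \<mu> x * g x * (exp (a x) / partition_fn a * \<bar>v x\<bar>) + \<mu> x * \<bar>f x\<bar> * \<bar>v x\<bar>"
    using \<mu> Z g_nonneg[OF x] by (simp add: abs_mult)
  finally show ?thesis
    using G Fv unfolding Z0_def by linarith
qed

lemma pairing_tendsto:
  assumes "F \<noteq> bot"
    and a: "\<And>x. ((\<lambda>i. a i x) \<longlongrightarrow> b x) F" "\<And>i. admissible (a i)"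
    and v: "\<And>x. ((\<lambda>i. v i x) \<longlongrightarrow> u x) F" "\<And>i. admissible (v i)"
  shows "((\<lambda>i. pairing (a i) (v i)) \<longlongrightarrow> pairing b u) F"
  unfolding pairing_def
proof (rule infsum_tendsto_tight[OF \<open>F \<noteq> bot\<close>])
  show "((\<lambda>i. \<mu> x * rhs (a i) x * v i x) \<longlongrightarrow> \<mu> x * rhs b x * u x) F" for x
    by (intro tendsto_intros rhs_tendsto v a \<open>F \<noteq> bot\<close>)
next
  fix i B assume B: "finite B" "B \<subseteq> V"
  \<comment> \<open>The energy bound gives the uniform square sums of \<open>v i\<close> that
    replace a common majorant.\<close>
  have "a0 * (\<Sum>x\<in>B. \<mu> x * (v i x)\<^sup>2) \<le> (\<Sum>x\<in>B. energy_density (v i) (v i) x)"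
    unfolding sum_distrib_left by (rule sum_mono) (use B energy_density_ge in auto)
  also have "\<dots> \<le> energy_bound"
    using v(2) B by (simp add: admissible_def)
  finally show "(\<Sum>x\<in>B. \<mu> x * (v i x)\<^sup>2) \<le> energy_bound / a0"
    using a0_pos by (simp add: field_simps)
next
  fix \<epsilon> :: real assume \<epsilon>: "\<epsilon> > 0"
  let ?b = "\<lambda>x. \<mu> x * g x * (exp sup_bound / (exp (- sup_bound) * partition_fn (\<lambda>_. 0)) * sup_bound)
    + \<mu> x * (f x)\<^sup>2 * (1 / (4 * \<epsilon>))"
  have "?b summable_on V"
    by (intro summable_on_add summable_on_cmult_left g_summable f_square_summable)
  moreover have "\<forall>x\<in>V. ?b x \<ge> 0"
  proof
    fix x assume x: "x \<in> V"
    show "?b x \<ge> 0"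
      using g_nonneg[OF x] measure_pos[OF x] \<epsilon> partition_fn_zero_pos sup_bound_ge
      by (intro add_nonneg_nonneg mult_nonneg_nonneg divide_nonneg_nonneg) auto
  qed
  moreover have "\<forall>i. \<forall>x\<in>V. \<bar>\<mu> x * rhs (a i) x * v i x\<bar> \<le> ?b x + \<epsilon> * (\<mu> x * (v i x)\<^sup>2)"
    using abs_rhs_mult_le[OF _ a(2) v(2) \<epsilon>] by blast
  ultimately show "\<exists>b. b summable_on V \<and> (\<forall>x\<in>V. 0 \<le> b x) \<and>
      (\<forall>\<^sub>F i in F. \<forall>x\<in>V. \<bar>\<mu> x * rhs (a i) x * v i x\<bar> \<le> b x + \<epsilon> * (\<mu> x * (v i x)\<^sup>2))"
    by (intro exI[of _ ?b] conjI) auto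
qed

text \<open>Testing the larger problem with the solution of the smaller one controls their distance.\<close>

lemma dirichlet_solution_energy_diff:
  assumes A: "A \<subseteq> A'" "finite A'" "A' \<subseteq> V" and B: "finite B" "B \<subseteq> V"
    and v: "dirichlet_solution A v" and u: "dirichlet_solution A' u"
  shows "(\<Sum>x\<in>B. energy_density (\<lambda>z. u z - v z) (\<lambda>z. u z - v z) x)
     \<le> pairing u u - 2 * pairing u v + pairing v v"
proof -
  define M where "M = B \<union> closed_nbhd A'"
  have M: "finite M" "M \<subseteq> V" "closed_nbhd A' \<subseteq> M" "closed_nbhd A \<subseteq> M"
    using closed_nbhd[of A'] A B by (auto simp: M_def closed_nbhd_def)
  have finA: "finite A" "A \<subseteq> V"
    using A finite_subset by auto
  have off: "\<And>x. x \<notin> A' \<Longrightarrow> u x = 0" "\<And>x. x \<notin> A \<Longrightarrow> v x = 0"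
    using u v by (auto simp: dirichlet_solution_def)
  have eq: "\<And>x. x \<in> A' \<Longrightarrow> schroedinger u x = rhs u x" "\<And>x. x \<in> A \<Longrightarrow> schroedinger v x = rhs v x"
    using u v by (auto simp: dirichlet_solution_def)
  have uu: "(\<Sum>x\<in>M. energy_density u u x) = pairing u u"
  proof -
    have "(\<Sum>x\<in>M. energy_density u u x) = (\<Sum>x\<in>A'. \<mu> x * schroedinger u x * u x)"
      by (rule sum_energy_density) (use A M off in auto)
    also have "\<dots> = (\<Sum>x\<in>A'. \<mu> x * rhs u x * u x)"
      by (rule sum.cong) (use A eq in auto)
    also have "\<dots> = pairing u u"
      by (rule pairing_finite_support[symmetric]) (use A off in auto)
    finally show ?thesis .
  qed
  \<comment> \<open>Since \<open>v\<close> lives on \<open>A\<close>, only the equation of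
    \<open>u\<close> on \<open>A\<close> is tested, and it holds there because \<open>A'\<close>
    contains \<open>A\<close>.\<close>
  have uv: "(\<Sum>x\<in>M. energy_density u v x) = pairing u v"
  proof -
    have "(\<Sum>x\<in>M. energy_density u v x) = (\<Sum>x\<in>A. \<mu> x * schroedinger u x * v x)"
      by (rule sum_energy_density) (use finA M off in auto)
    also have "\<dots> = (\<Sum>x\<in>A. \<mu> x * rhs u x * v x)"
      by (rule sum.cong) (use A eq in auto)
    also have "\<dots> = pairing u v"
      by (rule pairing_finite_support[symmetric]) (use finA off in auto)
    finally show ?thesis .
  qed
  have vv: "(\<Sum>x\<in>M. energy_density v v x) = pairing v v"
  proof -
    have "(\<Sum>x\<in>M. energy_density v v x) = (\<Sum>x\<in>A. \<mu> x * schroedinger v x * v x)"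
      by (rule sum_energy_density) (use finA M off in auto)
    also have "\<dots> = (\<Sum>x\<in>A. \<mu> x * rhs v x * v x)"
      by (rule sum.cong) (use A eq in auto)
    also have "\<dots> = pairing v v"
      by (rule pairing_finite_support[symmetric]) (use finA off in auto)
    finally show ?thesis .
  qed
  have "(\<Sum>x\<in>B. energy_density (\<lambda>z. u z - v z) (\<lambda>z. u z - v z) x)
      \<le> (\<Sum>x\<in>M. energy_density (\<lambda>z. u z - v z) (\<lambda>z. u z - v z) x)"
    by (rule sum_mono2) (use M energy_density_ge in \<open>auto simp: M_def\<close>)
  also have "\<dots> = (\<Sum>x\<in>M. energy_density (\<lambda>z. u z + (-1) * v z) (\<lambda>z. u z + (-1) * v z) x)"
    by simp
  also have "\<dots> = (\<Sum>x\<in>M. energy_density u u x) - 2 * (\<Sum>x\<in>M. energy_density u v x)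
      + (\<Sum>x\<in>M. energy_density v v x)"
    unfolding energy_density_add_scale by (simp add: sum.distrib sum_distrib_left sum_subtractf)
  finally show ?thesis
    by (simp add: uu uv vv)
qed

section \<open>Control of the Sobolev norm by the energy\<close>

lemma W12_integrand_le:
  assumes "x \<in> V"
  shows "\<mu> x * ((grad_norm E w \<mu> u x)\<^sup>2 + (u x)\<^sup>2) \<le> (1 + 1 / a0) * energy_density u u x"
proof -
  have "\<mu> x * (u x)\<^sup>2 \<le> energy_density u u x / a0"
    using energy_density_ge(1)[OF assms, of u] a0_pos by (simp add: field_simps)
  moreover have "\<mu> x * (grad_norm E w \<mu> u x)\<^sup>2 \<le> energy_density u u x"
    unfolding energy_density_self[OF assms] distrib_left
    using measure_pos[OF assms] potential_ge[OF assms] a0_pos by simp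
  ultimately show ?thesis
    by (simp add: distrib_left distrib_right)
qed

lemma W12_integrand_nonneg:
  "x \<in> V \<Longrightarrow> \<mu> x * ((grad_norm E w \<mu> u x)\<^sup>2 + (u x)\<^sup>2) \<ge> 0"
  using measure_pos[of x] by simp

lemma W12_integrand_sums:
  assumes "\<And>B. finite B \<Longrightarrow> B \<subseteq> V \<Longrightarrow> (\<Sum>x\<in>B. energy_density u u x) \<le> C"
    and B: "finite B" "B \<subseteq> V"
  shows "(\<Sum>x\<in>B. \<mu> x * ((grad_norm E w \<mu> u x)\<^sup>2 + (u x)\<^sup>2)) \<le> (1 + 1 / a0) * C"
proof -
  have "(\<Sum>x\<in>B. \<mu> x * ((grad_norm E w \<mu> u x)\<^sup>2 + (u x)\<^sup>2)) \<le>
      (1 + 1 / a0) * (\<Sum>x\<in>B. energy_density u u x)"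
    unfolding sum_distrib_left by (rule sum_mono) (use B W12_integrand_le in auto)
  also have "\<dots> \<le> (1 + 1 / a0) * C"
    using assms a0_pos by (intro mult_left_mono) auto
  finally show ?thesis .
qed

lemma W12_norm_le:
  assumes "\<And>B. finite B \<Longrightarrow> B \<subseteq> V \<Longrightarrow> (\<Sum>x\<in>B. energy_density u u x) \<le> C"
  shows "W12_norm V E w \<mu> u \<le> sqrt ((1 + 1 / a0) * C)"
  unfolding W12_norm_def vertex_integral_def
proof (intro real_sqrt_le_mono infsum_le_finite_sums)
  show "(\<lambda>x. \<mu> x * ((grad_norm E w \<mu> u x)\<^sup>2 + (u x)\<^sup>2)) summable_on V"
    by (rule summable_on_real_bounded_sums[OF W12_integrand_nonneg W12_integrand_sums[OF assms]])
qed (rule W12_integrand_sums[OF assms])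

section \<open>Construction of the solution\<close>

lemma solution_exists:
  "\<exists>u \<in> H_space V E w \<mu> h \<inter> Linf_space V. \<forall>x\<in>V. schroedinger u x = rhs u x"
proof -
  \<comment> \<open>The zero function serves as default for sets that are not finite subsets of
    \<open>V\<close>, so every \<open>s A\<close> is admissible.\<close>
  have "\<exists>u. admissible u \<and> (finite A \<and> A \<subseteq> V \<longrightarrow> dirichlet_solution A u)" for A
    using dirichlet_solution_exists[of A] admissible_zero by meson
  then obtain s where adm: "\<And>A. admissible (s A)"
    and sol: "\<And>A. finite A \<Longrightarrow> A \<subseteq> V \<Longrightarrow> dirichlet_solution A (s A)"
    by metis
  have "\<forall>\<^sub>F A in finite_subsets_at_top V. s A \<in> {u. \<forall>x. u x \<in> {- sup_bound..sup_bound}}"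
    using admissible_abs_le[OF adm] by (auto simp: abs_le_iff minus_le_iff)
  then obtain G u where G: "G \<le> finite_subsets_at_top V" "G \<noteq> bot" and su: "(s \<longlongrightarrow> u) G"
    by (rule compact_cluster_filter[OF compact_fun_box[OF compact_Icc] finite_subsets_at_top_neq_bot])
  note lim = tendsto_fun_apply[OF su]
  have u: "admissible u"
    by (rule admissible_limit[OF G(2) lim adm])
  have ev: "\<forall>\<^sub>F A' in G. finite A' \<and> A \<subseteq> A' \<and> A' \<subseteq> V" if "finite A" "A \<subseteq> V" for A
    using that by (intro filter_leD[OF G(1)]) (auto simp: eventually_finite_subsets_at_top)
  \<comment> \<open>Along \<open>G\<close> the vertex \<open>x\<close> eventually lies in
    \<open>A\<close>, where \<open>s A\<close> solves the equation; both sides converge.\<close>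
  have eq: "schroedinger u x = rhs u x" if x: "x \<in> V" for x
  proof (rule tendsto_unique[OF G(2)])
    show "((\<lambda>A. schroedinger (s A) x) \<longlongrightarrow> schroedinger u x) G"
      unfolding schroedinger_def laplacian_def by (intro tendsto_intros lim)
    have "\<forall>\<^sub>F A in G. rhs (s A) x = schroedinger (s A) x"
      using ev[of "{x}"]
    proof (rule eventually_mono)
      fix A assume "finite A \<and> {x} \<subseteq> A \<and> A \<subseteq> V"
      then show "rhs (s A) x = schroedinger (s A) x"
        using sol[of A] by (simp add: dirichlet_solution_def)
    qed (use x in auto)
    then show "((\<lambda>A. schroedinger (s A) x) \<longlongrightarrow> rhs u x) G"
      by (rule Lim_transform_eventually[OF rhs_tendsto[OF G(2) lim adm]])
  qed
  \<comment> \<open>The limit along \<open>A'\<close> of the energy estimate between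
    \<open>s A'\<close> and \<open>s A\<close>, with \<open>A\<close> held fixed.\<close>
  define gap where "gap A = pairing u u - 2 * pairing u (s A) + pairing (s A) (s A)" for A
  have gap: "(\<Sum>x\<in>B. energy_density (\<lambda>z. u z - s A z) (\<lambda>z. u z - s A z) x) \<le> gap A"
    if A: "finite A" "A \<subseteq> V" and B: "finite B" "B \<subseteq> V" for A B
  proof (rule tendsto_le[OF G(2)])
    show "((\<lambda>A'. \<Sum>x\<in>B. energy_density (\<lambda>z. s A' z - s A z) (\<lambda>z. s A' z - s A z) x) \<longlongrightarrow>
        (\<Sum>x\<in>B. energy_density (\<lambda>z. u z - s A z) (\<lambda>z. u z - s A z) x)) G"
      by (intro tendsto_sum energy_density_tendsto tendsto_intros lim)
    show "((\<lambda>A'. pairing (s A') (s A') - 2 * pairing (s A') (s A) + pairing (s A) (s A)) \<longlongrightarrow> gap A) G"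
      unfolding gap_def by (intro tendsto_intros pairing_tendsto G(2) lim adm)
    show "\<forall>\<^sub>F A' in G. (\<Sum>x\<in>B. energy_density (\<lambda>z. s A' z - s A z) (\<lambda>z. s A' z - s A z) x)
        \<le> pairing (s A') (s A') - 2 * pairing (s A') (s A) + pairing (s A) (s A)"
      using ev[OF A]
    proof (rule eventually_mono)
      fix A' assume "finite A' \<and> A \<subseteq> A' \<and> A' \<subseteq> V"
      then show "(\<Sum>x\<in>B. energy_density (\<lambda>z. s A' z - s A z) (\<lambda>z. s A' z - s A z) x)
          \<le> pairing (s A') (s A') - 2 * pairing (s A') (s A) + pairing (s A) (s A)"
        using dirichlet_solution_energy_diff[of A A' B "s A" "s A'"] B sol[of A'] sol[OF A] by simp
    qed
  qed
  \<comment> \<open>Now \<open>A\<close> itself moves along \<open>G\<close>; all pairings tend to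
    the same value, with coefficients 1, -2 and 1.\<close>
  have "(gap \<longlongrightarrow> pairing u u - 2 * pairing u u + pairing u u) G"
    unfolding gap_def by (intro tendsto_intros pairing_tendsto G(2) lim adm u)
  then have gap_lim: "(gap \<longlongrightarrow> 0) G"
    by simp
  have sums: "(\<Sum>x\<in>B. energy_density u u x) \<le> energy_bound" if "finite B" "B \<subseteq> V" for B
    using u that by (simp add: admissible_def)
  have "u \<in> W12_space V E w \<mu>"
    unfolding W12_space_def vertex_integrable_def mem_Collect_eq
    by (rule summable_on_real_bounded_sums[OF W12_integrand_nonneg W12_integrand_sums[OF sums]])
  moreover have "\<exists>\<phi>\<in>Cc_space V. W12_norm V E w \<mu> (\<lambda>x. u x - \<phi> x) < \<epsilon>" if \<epsilon>: "\<epsilon> > 0" for \<epsilon>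
  proof -
    have "\<epsilon>\<^sup>2 / (1 + 1 / a0) > 0"
      using \<epsilon> a0_pos by (simp add: add_pos_pos)
    then have "\<forall>\<^sub>F A in G. gap A < \<epsilon>\<^sup>2 / (1 + 1 / a0)"
      using gap_lim by (rule order_tendstoD(2)[rotated])
    then have "\<forall>\<^sub>F A in G. finite A \<and> A \<subseteq> V \<and> gap A < \<epsilon>\<^sup>2 / (1 + 1 / a0)"
      using ev[OF finite.emptyI empty_subsetI] by eventually_elim auto
    then obtain A where A: "finite A" "A \<subseteq> V" "gap A < \<epsilon>\<^sup>2 / (1 + 1 / a0)"
      using eventually_happens'[OF G(2)] by blast
    have "W12_norm V E w \<mu> (\<lambda>x. u x - s A x) \<le> sqrt ((1 + 1 / a0) * gap A)"
      using A by (intro W12_norm_le gap)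
    also have "\<dots> < sqrt (\<epsilon>\<^sup>2)"
    proof -
      have "1 + 1 / a0 > 0"
        using a0_pos by (simp add: add_pos_pos)
      then show ?thesis
        using A(3) by (simp only: real_sqrt_less_iff pos_less_divide_eq mult.commute)
    qed
    also have "\<dots> = \<epsilon>"
      using \<epsilon> by simp
    finally have "W12_norm V E w \<mu> (\<lambda>x. u x - s A x) < \<epsilon>" .
    moreover have "{x \<in> V. s A x \<noteq> 0} \<subseteq> A"
      using sol[OF A(1,2)] by (auto simp: dirichlet_solution_def)
    then have "s A \<in> Cc_space V"
      using A(1) finite_subset by (auto simp: Cc_space_def)
    ultimately show ?thesis
      by blast
  qed
  ultimately have "u \<in> W012_space V E w \<mu>"
    by (simp add: W012_space_def)
  moreover have "energy_density u u summable_on V"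
    by (rule summable_on_real_bounded_sums[OF energy_density_ge(2) sums])
  then have "vertex_integrable V \<mu> (\<lambda>x. (grad_norm E w \<mu> u x)\<^sup>2 + h x * (u x)\<^sup>2)"
    unfolding vertex_integrable_def
    by (rule summable_on_cong[THEN iffD1, rotated]) (rule energy_density_self)
  ultimately have "u \<in> H_space V E w \<mu> h"
    by (simp add: H_space_def)
  moreover have "u \<in> Linf_space V"
    unfolding Linf_space_def using admissible_abs_le[OF u] by (auto simp: bounded_iff)
  ultimately show ?thesis
    using eq by blast
qed

end

section \<open>Reduction of the stated hypotheses to the working ones\<close>

text \<open>Balls are defined by a strict inequality, so \<open>k = 2\<close> is the radius whose
  ball contains all neighbours.\<close>

lemma locally_finite_graph_neighbours:
  assumes "connected_weighted_graph V E w \<mu>" "locally_finite_graph V E" "x \<in> V"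
  shows "finite {y. (x, y) \<in> E}"
proof -
  interpret connected_weighted_graph V E w \<mu>
    by fact
  have "{y. (x, y) \<in> E} \<subseteq> {y \<in> V. graph_dist E y x < 2}"
  proof safe
    fix y assume xy: "(x, y) \<in> E"
    then show "y \<in> V"
      using edges_in_verts by auto
    have "(y, x) \<in> E ^^ 1"
      using xy sym_edges by (auto dest: symD)
    then have "graph_dist E y x \<le> 1"
      unfolding graph_dist_def by (rule Least_le)
    then show "graph_dist E y x < 2"
      by simp
  qed
  moreover have "finite {y \<in> V. graph_dist E y x < 2}"
    using assms(2,3) unfolding locally_finite_graph_def by simp
  ultimately show ?thesis
    by (rule finite_subset)
qed

text \<open>Since \<open>\<mu>\<close> is bounded below, membership in \<open>L\<^sup>q\<close> forces boundedness, so the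
  \<open>L\<^sup>q\<close> spaces increase with \<open>q\<close>.\<close>

lemma Lq_space_imp_square_summable:
  assumes \<mu>0: "\<mu>0 > 0" "\<And>x. x \<in> V \<Longrightarrow> \<mu> x \<ge> \<mu>0" and q: "1 \<le> q" "q \<le> 2" and f: "f \<in> Lq_space V \<mu> q"
  shows "(\<lambda>x. \<mu> x * (f x)\<^sup>2) summable_on V"
proof -
  define I where "I = (\<Sum>\<^sub>\<infinity>x\<in>V. \<mu> x * \<bar>f x\<bar> powr q)"
  have sum: "(\<lambda>x. \<mu> x * \<bar>f x\<bar> powr q) summable_on V"
    using f by (simp add: Lq_space_def vertex_integrable_def)
  have \<mu>: "\<mu> x > 0" if "x \<in> V" for x
    using \<mu>0 that by fastforce
  \<comment> \<open>A single term of the sum is at most \<open>I\<close> and carries a weight of at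
    least \<open>\<mu>0\<close>; this makes \<open>M\<close> a bound for the absolute value of
    \<open>f\<close> on \<open>V\<close>.\<close>
  define M where "M = (I / \<mu>0) powr (1 / q)"
  have M: "\<bar>f x\<bar> \<le> M" if x: "x \<in> V" for x
  proof -
    have "\<mu>0 * \<bar>f x\<bar> powr q \<le> \<mu> x * \<bar>f x\<bar> powr q"
      using \<mu>0(2)[OF x] by (intro mult_right_mono) auto
    also have "\<dots> = (\<Sum>x\<in>{x}. \<mu> x * \<bar>f x\<bar> powr q)"
      by simp
    also have "\<dots> \<le> I"
      unfolding I_def by (rule finite_sum_le_infsum[OF sum]) (use x \<mu> in \<open>auto simp: less_imp_le\<close>)
    finally have "\<bar>f x\<bar> powr q \<le> I / \<mu>0"
      using \<mu>0(1) by (simp add: field_simps)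
    then have "(\<bar>f x\<bar> powr q) powr (1 / q) \<le> M"
      unfolding M_def using q by (intro powr_mono2) auto
    then show ?thesis
      using q by (simp add: powr_powr)
  qed
  show ?thesis
  proof (rule summable_on_comparison_test)
    show "(\<lambda>x. \<mu> x * \<bar>f x\<bar> powr q * M powr (2 - q)) summable_on V"
      using sum by (rule summable_on_cmult_left)
    fix x assume x: "x \<in> V"
    \<comment> \<open>The surplus exponent \<open>2 - q\<close> is nonnegative, so its power is
      bounded through \<open>M\<close>.\<close>
    have "(f x)\<^sup>2 = \<bar>f x\<bar> powr (q + (2 - q))"
      by (cases "f x = 0") (simp_all add: powr_numeral)
    also have "\<dots> = \<bar>f x\<bar> powr q * \<bar>f x\<bar> powr (2 - q)"
      by (rule powr_add)
    also have "\<dots> \<le> \<bar>f x\<bar> powr q * M powr (2 - q)"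
      using M[OF x] q by (intro mult_left_mono powr_mono2) auto
    finally show "\<mu> x * (f x)\<^sup>2 \<le> \<mu> x * \<bar>f x\<bar> powr q * M powr (2 - q)"
      using \<mu>[OF x] by (simp add: mult.assoc)
  qed (use \<mu> in \<open>auto simp: less_imp_le\<close>)
qed

theorem theorem5:
  fixes V :: "'a set" and E :: "('a \<times> 'a) set"
    and w :: "'a \<Rightarrow> 'a \<Rightarrow> real" and \<mu> :: "'a \<Rightarrow> real"
    and h g f :: "'a \<Rightarrow> real"
  assumes "connected_weighted_graph V E w \<mu>"
    and "locally_finite_graph V E"
    and "\<exists>\<mu>0>0. \<forall>x\<in>V. \<mu> x \<ge> \<mu>0"
    and "\<exists>a0>0. \<forall>x\<in>V. h x \<ge> a0"
    and "\<forall>x\<in>V. g x \<ge> 0"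
    and "\<exists>x\<in>V. g x \<noteq> 0"
    and "g \<in> Lq_space V \<mu> 1"
    and "\<exists>q\<in>{1..2}. f \<in> Lq_space V \<mu> q"
  shows "\<exists>u \<in> H_space V E w \<mu> h \<inter> Linf_space V. \<forall>x\<in>V.
           - laplacian E w \<mu> u x + h x * u x =
             g x * exp (u x) / vertex_integral V \<mu> (\<lambda>y. g y * exp (u y)) - f x"
proof -
  interpret connected_weighted_graph V E w \<mu>
    by fact
  obtain \<mu>0 a0 where \<mu>0: "\<mu>0 > 0" "\<And>x. x \<in> V \<Longrightarrow> \<mu> x \<ge> \<mu>0" and a0: "a0 > 0" "\<And>x. x \<in> V \<Longrightarrow> h x \<ge> a0"
    using assms(3,4) by blast
  have "(\<lambda>x. \<mu> x * \<bar>g x\<bar> powr 1) summable_on V"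
    using assms(7) by (simp add: Lq_space_def vertex_integrable_def)
  then have g: "(\<lambda>x. \<mu> x * g x) summable_on V"
    by (rule summable_on_cong[THEN iffD1, rotated]) (use assms(5) in auto)
  have f: "(\<lambda>x. \<mu> x * (f x)\<^sup>2) summable_on V"
    using assms(8) Lq_space_imp_square_summable[of \<mu>0 V \<mu>, OF \<mu>0] by auto
  interpret mean_field_problem V E w \<mu> h g f a0 \<mu>0
    by unfold_locales
      (use \<mu>0 a0 g f assms(5,6) locally_finite_graph_neighbours[OF assms(1,2)] in auto)
  show ?thesis
    using solution_exists unfolding schroedinger_def rhs_def partition_fn_def .
qed

end
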